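(* Let $N\ge 1$ be an integer, let $q$ be a primitive $N$-th root of unity (for instance $q=e^{2\pi i/N}$), and let $\alpha,\beta$ be real numbers with $\alpha>-1$, $\beta>-1$. For $k=0,1,\dots,N-1$ set, if $N$ is even, $$A_k(z;N)=\sigma_k\,\frac{z^2}{q^k-z^2},\qquad \sigma_k=\alpha+\beta+1+(-1)^k(\alpha-\beta),$$ and, if $N$ is odd, $$A_k(z;N)=\frac{(\alpha+\beta+1)z^2+\rho_k(\alpha-\beta)z}{q^k-z^2},\qquad \rho_k=\begin{cases}q^{k/2},& k\text{ even},\\ q^{(k-N)/2},& k\text{ odd}.\end{cases}$$ Let $$L(N)=z\partial_z+\sum_{k=0}^{N-1}A_k(z;N)\,(R_k-\mathcal I),\qquad R_kf(z)=f(q^k/z),$$ where $\mathcal I$ is the identity operator. Then the CMV-Laurent polynomials $\psi_n(z;N)$ associated to the sieved Jacobi polynomials on the unit circle $\Phi_n(z;N)$ with parameters $\alpha,\beta$ satisfy, for all $n=0,1,2,\dots$, $$L(N)\,\psi_n(z;N)=\lambda_n(N)\,\psi_n(z;N),$$ with $$\lambda_n(N)=\begin{cases}-n/2,& n\text{ even},\\ (n+1)/2+(\alpha+\beta+1)N,& n\text{ odd}.\end{cases}$$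
   Context: Jacobi Verblunsky parameters: $a_n=-\dfrac{\alpha+1/2+(-1)^{n+1}(\beta+1/2)}{n+\alpha+\beta+2}$, $n=0,1,2,\dots$. For $\alpha,\beta>-1$ one has $|a_n|<1$ for all $n$. Sieved Verblunsky parameters: $a_n(N)=a_{k-1}$ if $n=Nk-1$ for some integer $k\ge1$, and $a_n(N)=0$ otherwise. The sieved Jacobi polynomials on the unit circle $\Phi_n(z;N)$ are the monic polynomials defined by $\Phi_0(z;N)=1$ and $\Phi_{n+1}(z;N)=z\Phi_n(z;N)-a_n(N)\,\Phi_n^*(z;N)$, where $\Phi_n^*(z;N)=z^n\Phi_n(1/z;N)$ (all coefficients are real). The associated CMV-Laurent polynomials are $\psi_{2n}(z;N)=z^n\Phi_{2n}(1/z;N)$ and $\psi_{2n+1}(z;N)=z^{-n}\Phi_{2n+1}(z;N)$, $n\ge0$. *)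

theory Defs
  imports
    "HOL-Analysis.Analysis"
    "HOL-Computational_Algebra.Polynomial"
begin

definition primitive_unity_root :: "nat \<Rightarrow> complex \<Rightarrow> bool" where
  "primitive_unity_root N q \<longleftrightarrow> q ^ N = 1 \<and> (\<forall>m. 0 < m \<and> m < N \<longrightarrow> q ^ m \<noteq> 1)"

definition jacobi_verblunsky :: "real \<Rightarrow> real \<Rightarrow> nat \<Rightarrow> real" where
  "jacobi_verblunsky \<alpha> \<beta> n =
     - (\<alpha> + 1/2 + (-1) ^ (n + 1) * (\<beta> + 1/2)) / (real n + \<alpha> + \<beta> + 2)"

(* n = N k - 1 with k >= 1 means N dvd n + 1, and then k = (n + 1) div N;
   see sieved_verblunsky_hit and sieved_verblunsky_miss. *)
definition sieved_verblunsky :: "nat \<Rightarrow> real \<Rightarrow> real \<Rightarrow> nat \<Rightarrow> real" where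
  "sieved_verblunsky N \<alpha> \<beta> n =
     (if N dvd n + 1 then jacobi_verblunsky \<alpha> \<beta> ((n + 1) div N - 1) else 0)"

lemma sieved_verblunsky_hit:
  assumes "N \<ge> 1" "k \<ge> 1"
  shows "sieved_verblunsky N \<alpha> \<beta> (N * k - 1) = jacobi_verblunsky \<alpha> \<beta> (k - 1)"
proof -
  from assms have "N * k - 1 + 1 = N * k" by (cases "N * k") auto
  with assms show ?thesis unfolding sieved_verblunsky_def by simp
qed

lemma sieved_verblunsky_miss:
  assumes "\<not> (\<exists>k\<ge>1. n = N * k - 1)"
  shows "sieved_verblunsky N \<alpha> \<beta> n = 0"
proof -
  have "\<not> N dvd n + 1"
  proof
    assume "N dvd n + 1"
    then obtain k where k: "n + 1 = N * k" by (rule dvdE)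
    then have "k \<ge> 1" by (cases k) auto
    moreover from k have "n = N * k - 1" by linarith
    ultimately show False using assms by blast
  qed
  then show ?thesis by (simp add: sieved_verblunsky_def)
qed

(* The polynomial z ^ n * p (1 / z) for degree p <= n; see poly_reversed_poly.
   Unlike reflect_poly, the formal degree n is explicit.  Coefficients are not
   conjugated: all polynomials here have real coefficients. *)
definition reversed_poly :: "nat \<Rightarrow> complex poly \<Rightarrow> complex poly" where
  "reversed_poly n p = (\<Sum>i\<le>n. monom (coeff p (n - i)) i)"

lemma poly_reversed_poly:
  assumes "degree p \<le> n" "z \<noteq> 0"
  shows "poly (reversed_poly n p) z = z ^ n * poly p (1 / z)"
proof -
  have "poly p (1 / z) = (\<Sum>i\<le>n. coeff p i * (1 / z) ^ i)"
    unfolding poly_altdef using assms(1)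
    by (intro sum.mono_neutral_left) (auto simp: coeff_eq_0)
  also have "z ^ n * \<dots> = (\<Sum>i\<le>n. coeff p i * z ^ (n - i))"
    unfolding sum_distrib_left
    using assms(2) by (intro sum.cong) (auto simp: power_diff field_simps)
  also have "\<dots> = (\<Sum>i\<le>n. coeff p (n - i) * z ^ i)"
    by (rule sum.reindex_bij_witness[of _ "\<lambda>i. n - i" "\<lambda>i. n - i"]) auto
  also have "\<dots> = poly (reversed_poly n p) z"
    by (simp add: reversed_poly_def poly_sum poly_monom)
  finally show ?thesis by simp
qed

fun sieved_Phi :: "nat \<Rightarrow> real \<Rightarrow> real \<Rightarrow> nat \<Rightarrow> complex poly" where
  "sieved_Phi N \<alpha> \<beta> 0 = 1"
| "sieved_Phi N \<alpha> \<beta> (Suc n) =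
     [:0, 1:] * sieved_Phi N \<alpha> \<beta> n
       - smult (of_real (sieved_verblunsky N \<alpha> \<beta> n)) (reversed_poly n (sieved_Phi N \<alpha> \<beta> n))"

lemma degree_reversed_poly_le: "degree (reversed_poly n p) \<le> n"
  unfolding reversed_poly_def
  by (intro degree_sum_le) (auto intro: order.trans[OF degree_monom_le])

lemma sieved_Phi_monic:
  "degree (sieved_Phi N \<alpha> \<beta> n) = n \<and> lead_coeff (sieved_Phi N \<alpha> \<beta> n) = 1"
proof (induction n)
  case (Suc n)
  define p where "p = sieved_Phi N \<alpha> \<beta> n"
  define r where "r = smult (of_real (sieved_verblunsky N \<alpha> \<beta> n)) (reversed_poly n p)"
  have p: "degree p = n" "coeff p n = 1" using Suc by (auto simp: p_def)
  have eq: "sieved_Phi N \<alpha> \<beta> (Suc n) = pCons 0 p - r"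
    by (simp add: p_def r_def)
  have r: "degree r \<le> n"
    unfolding r_def by (rule order.trans[OF degree_smult_le degree_reversed_poly_le])
  have c: "coeff (pCons 0 p - r) (Suc n) = 1"
    using p r by (simp add: coeff_eq_0)
  have "degree (pCons 0 p - r) \<le> Suc n"
    using p r by (intro degree_diff_le) (auto intro: order.trans[OF degree_pCons_le])
  moreover have "Suc n \<le> degree (pCons 0 p - r)"
    using c by (intro le_degree) simp
  ultimately have "degree (pCons 0 p - r) = Suc n" by simp
  then show ?case using c unfolding eq by simp
qed simp

(* Laurent polynomials are represented by the functions they induce on z \<noteq> 0. *)
definition cmv_psi :: "nat \<Rightarrow> real \<Rightarrow> real \<Rightarrow> nat \<Rightarrow> complex \<Rightarrow> complex" where
  "cmv_psi N \<alpha> \<beta> n z =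
     (if even n then z ^ (n div 2) * poly (sieved_Phi N \<alpha> \<beta> n) (1 / z)
      else z powi (- int (n div 2)) * poly (sieved_Phi N \<alpha> \<beta> n) z)"

definition sieved_sigma :: "real \<Rightarrow> real \<Rightarrow> nat \<Rightarrow> real" where
  "sieved_sigma \<alpha> \<beta> k = \<alpha> + \<beta> + 1 + (-1) ^ k * (\<alpha> - \<beta>)"

(* Used for odd N only, so that k - N is even whenever k is odd and the division is exact. *)
definition sieved_rho :: "nat \<Rightarrow> complex \<Rightarrow> nat \<Rightarrow> complex" where
  "sieved_rho N q k = (if even k then q ^ (k div 2) else q powi ((int k - int N) div 2))"

definition sieved_A :: "nat \<Rightarrow> complex \<Rightarrow> real \<Rightarrow> real \<Rightarrow> nat \<Rightarrow> complex \<Rightarrow> complex" where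
  "sieved_A N q \<alpha> \<beta> k z =
     (if even N then of_real (sieved_sigma \<alpha> \<beta> k) * (z\<^sup>2 / (q ^ k - z\<^sup>2))
      else (of_real (\<alpha> + \<beta> + 1) * z\<^sup>2 + sieved_rho N q k * of_real (\<alpha> - \<beta>) * z)
             / (q ^ k - z\<^sup>2))"

definition refl_op :: "complex \<Rightarrow> nat \<Rightarrow> (complex \<Rightarrow> complex) \<Rightarrow> complex \<Rightarrow> complex" where
  "refl_op q k f z = f (q ^ k / z)"

(* The coefficients have poles where z ^ 2 = q ^ k for some k < N, and the reflections
   need z \<noteq> 0; elsewhere the value is meaningful. *)
definition sieved_L ::
  "nat \<Rightarrow> complex \<Rightarrow> real \<Rightarrow> real \<Rightarrow> (complex \<Rightarrow> complex) \<Rightarrow> complex \<Rightarrow> complex" where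
  "sieved_L N q \<alpha> \<beta> f z =
     z * deriv f z + (\<Sum>k<N. sieved_A N q \<alpha> \<beta> k z * (refl_op q k f z - f z))"

definition sieved_lambda :: "nat \<Rightarrow> real \<Rightarrow> real \<Rightarrow> nat \<Rightarrow> real" where
  "sieved_lambda N \<alpha> \<beta> n =
     (if even n then - (real n / 2) else (real n + 1) / 2 + (\<alpha> + \<beta> + 1) * real N)"

end

theory Submission
  imports Defs
begin

text \<open>
  The theorem reduces to the case \<open>N = 1\<close>. Most sieved Verblunsky parameters vanish, and a
  vanishing parameter multiplies \<open>\<Phi>\<close> by \<open>z\<close> and leaves \<open>\<Phi>\<^sup>*\<close> alone; hence
  \<open>\<Phi>\<close> of index \<open>N k + j\<close> with \<open>0 \<le> j < N\<close> is \<open>z ^ j\<close> times the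
  unsieved \<open>\<Phi>\<close> of index \<open>k\<close>, taken at \<open>z ^ N\<close>
  (\<open>sieved_Phi_conv_jacobi\<close>). Consequently every \<open>\<psi>\<close> of index \<open>n\<close> has one of the two forms
  \<open>g (z ^ N) / z ^ c\<close> with \<open>2 c < N\<close>, or \<open>z ^ c g (1 / z ^ N)\<close> with \<open>0 < 2 c \<le> N\<close>, where
  \<open>g\<close> is the unsieved \<open>\<psi>\<close> of index \<open>k\<close>; the first form occurs exactly if \<open>n\<close> and
  \<open>k\<close> have the same parity (\<open>cmv_psi_conv_jacobi\<close>).

  On such functions the reflections \<open>R\<^sub>k\<close> differ from each other only by a power of \<open>q ^ k\<close>, because
  \<open>(q ^ k / z) ^ N\<close> does not depend on \<open>k\<close>. So \<open>L(N)\<close> acts through the sums of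
  \<open>A\<^sub>k q ^ (k m)\<close> over \<open>k\<close>, which the partial fraction expansion of \<open>w ^ (m - 1) / (1 - w ^ N)\<close>
  at \<open>w = z\<^sup>2\<close> evaluates in closed form. The bounds on \<open>c\<close> are what makes these closed forms
  proportional to the coefficient of \<open>L(1)\<close> at \<open>Z = z ^ N\<close>, and they lead to
  \<open>L(N) f = (N L(1) g - c g) / z ^ c\<close> for the first form and, with
  \<open>s = \<alpha> + \<beta> + 1\<close>, to \<open>L(N) f = z ^ c (c g + N (s g - L(1) g))\<close> for the second
  (\<open>sieved_L_pullback\<close>, \<open>sieved_L_pullback_inverse\<close>). An eigenfunction of \<open>L(1)\<close> therefore
  gives eigenfunctions of \<open>L(N)\<close>, and the eigenvalues match.

  For \<open>N = 1\<close> the eigenvalue equation is a first order relation between \<open>\<Phi>\<close>,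
  \<open>\<Phi>\<^sup>*\<close> and one derivative. Together with its image under reversal it forms a linear
  differential system for the pair \<open>(\<Phi>, \<Phi>\<^sup>*)\<close>, with different shapes for even and odd
  index. The Szego recurrence carries each shape into the other, and this compatibility
  is precisely what determines the Jacobi parameters (\<open>jacobi_Phi_differential_system\<close>).
\<close>

section \<open>Roots of unity\<close>

lemma primitive_unity_root_power_eq_1_iff:
  assumes "N \<ge> 1" "primitive_unity_root N q"
  shows "q ^ m = 1 \<longleftrightarrow> N dvd m"
proof -
  have qN: "q ^ N = 1" and min: "\<And>m. 0 < m \<Longrightarrow> m < N \<Longrightarrow> q ^ m \<noteq> 1"
    using assms by (auto simp: primitive_unity_root_def)
  have "q ^ m = q ^ (N * (m div N) + m mod N)" by simp
  also have "\<dots> = q ^ (m mod N)"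
    unfolding power_add power_mult by (simp add: qN)
  finally have "q ^ m = q ^ (m mod N)" .
  moreover have "m mod N < N" using assms by simp
  ultimately show ?thesis
    using min[of "m mod N"] by (auto simp: dvd_eq_mod_eq_0)
qed

lemma power_primitive_root_power_eq_1:
  assumes "primitive_unity_root N q"
  shows "(q ^ k) ^ N = 1"
  using assms by (metis mult.commute power_mult power_one primitive_unity_root_def)

lemma primitive_unity_root_nonzero:
  assumes "N \<ge> 1" "primitive_unity_root N q"
  shows "q \<noteq> 0"
  using assms by (auto simp: primitive_unity_root_def power_0_left)

lemma sum_powers_primitive_root:
  assumes "N \<ge> 1" "primitive_unity_root N q"
  shows "(\<Sum>k<N. (q ^ k) ^ m) = (if N dvd m then of_nat N else 0)"
proof -
  have eq: "(\<Sum>k<N. (q ^ k) ^ m) = (\<Sum>k<N. (q ^ m) ^ k)"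
    by (simp add: power_mult [symmetric] mult.commute)
  show ?thesis
  proof (cases "N dvd m")
    case True
    then have "q ^ m = 1" using primitive_unity_root_power_eq_1_iff[OF assms] by simp
    then show ?thesis using True by (simp add: eq)
  next
    case False
    then have "q ^ m \<noteq> 1" using primitive_unity_root_power_eq_1_iff[OF assms] by simp
    moreover note power_primitive_root_power_eq_1[OF assms(2), of m]
    ultimately show ?thesis using False by (simp add: eq geometric_sum)
  qed
qed

text \<open>
  Multiplying by \<open>1 - w ^ N = (q ^ k) ^ N - w ^ N\<close> turns each quotient into a geometric sum, and
  summing over \<open>k\<close> first leaves one power of \<open>w\<close> by orthogonality. The same computation
  rules out \<open>w ^ N = 1\<close>, since then every geometric sum would be zero.
\<close>

lemma sum_partial_fractions_primitive_root:
  assumes N: "N \<ge> 1" and q: "primitive_unity_root N q"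
    and w: "w \<noteq> 0" "\<forall>k<N. w \<noteq> q ^ k"
    and m: "1 \<le> m" "m \<le> N"
  shows "w ^ N \<noteq> 1"
    and "(\<Sum>k<N. (q ^ k) ^ m / (q ^ k - w)) = of_nat N * w ^ (m - 1) / (1 - w ^ N)"
proof -
  note qkN = power_primitive_root_power_eq_1[OF q]
  have quot: "(1 - w ^ N) / (q ^ k - w) = (\<Sum>i<N. (q ^ k) ^ (N - Suc i) * w ^ i)" if "k < N" for k
  proof -
    have "w ^ N - (q ^ k) ^ N = (w - q ^ k) * (\<Sum>i<N. (q ^ k) ^ (N - Suc i) * w ^ i)"
      by (rule power_diff_sumr2)
    then have "1 - w ^ N = (q ^ k - w) * (\<Sum>i<N. (q ^ k) ^ (N - Suc i) * w ^ i)"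
      unfolding qkN by (simp add: algebra_simps)
    moreover have "q ^ k - w \<noteq> 0" using w(2) that by auto
    ultimately show ?thesis by simp
  qed
  have "(\<Sum>k<N. (q ^ k) ^ m * ((1 - w ^ N) / (q ^ k - w)))
      = (\<Sum>k<N. \<Sum>i<N. w ^ i * (q ^ k) ^ (m + (N - Suc i)))"
    by (intro sum.cong refl) (simp only: quot sum_distrib_left power_add mult_ac lessThan_iff)
  also have "\<dots> = (\<Sum>i<N. w ^ i * (\<Sum>k<N. (q ^ k) ^ (m + (N - Suc i))))"
    by (subst sum.swap) (simp add: sum_distrib_left)
  also have "\<dots> = (\<Sum>i<N. if i = m - 1 then w ^ i * of_nat N else 0)"
  proof (intro sum.cong refl)
    fix i assume "i \<in> {..<N}"
    then have i: "i < N" by simp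
    \<comment> \<open>The exponent lies strictly between 0 and 2 N, so N is the only multiple it can be.\<close>
    have "N dvd m + (N - Suc i) \<longleftrightarrow> i = m - 1"
    proof
      assume "N dvd m + (N - Suc i)"
      then obtain t where t: "m + (N - Suc i) = N * t" by (rule dvdE)
      have "0 < N * t" "N * t < N * 2" using t m i by linarith+
      then have "t = 1" by simp
      then show "i = m - 1" using t i m by simp
    next
      assume "i = m - 1"
      then show "N dvd m + (N - Suc i)" using m by simp
    qed
    then show "w ^ i * (\<Sum>k<N. (q ^ k) ^ (m + (N - Suc i)))
        = (if i = m - 1 then w ^ i * of_nat N else 0)"
      by (simp add: sum_powers_primitive_root[OF N q])
  qed
  also have "\<dots> = of_nat N * w ^ (m - 1)"
    using m by (simp add: mult.commute)
  finally have main: "(\<Sum>k<N. (q ^ k) ^ m * ((1 - w ^ N) / (q ^ k - w))) = of_nat N * w ^ (m - 1)" .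
  show ne: "w ^ N \<noteq> 1"
  proof
    assume "w ^ N = 1"
    then have "of_nat N * w ^ (m - 1) = 0" using main by simp
    then show False using w N by simp
  qed
  have "(\<Sum>k<N. (q ^ k) ^ m * ((1 - w ^ N) / (q ^ k - w)))
      = (1 - w ^ N) * (\<Sum>k<N. (q ^ k) ^ m / (q ^ k - w))"
    by (simp add: sum_distrib_left mult_ac)
  then show "(\<Sum>k<N. (q ^ k) ^ m / (q ^ k - w)) = of_nat N * w ^ (m - 1) / (1 - w ^ N)"
    using main ne by (simp add: field_simps)
qed

section \<open>Sums of the reflection coefficients\<close>

text \<open>
  For odd \<open>N\<close> the number \<open>q ^ ((N + 1) / 2)\<close> is the square root of \<open>q\<close> among the powers of
  \<open>q\<close>; both cases in the definition of \<open>\<rho>\<^sub>k\<close> are its \<open>k\<close>-th power.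
\<close>

lemma sieved_rho_conv_power:
  assumes "odd N" "q ^ N = 1"
  shows "sieved_rho N q k = (q ^ k) ^ ((N + 1) div 2)"
proof -
  obtain h where h: "N = 2 * h + 1" using assms(1) by (rule oddE)
  have q0: "q \<noteq> 0" using assms(2) h by auto
  have sq: "q ^ (2 * (i * Suc h)) = q ^ i" for i
  proof -
    have "q ^ (2 * (i * Suc h)) = q ^ (N * i + i)" by (simp add: h algebra_simps)
    then show ?thesis by (simp add: power_add power_mult assms(2))
  qed
  show ?thesis
  proof (cases "even k")
    case True
    then obtain i where i: "k = 2 * i" by (rule evenE)
    then have "(q ^ k) ^ Suc h = q ^ i"
      using sq[of i] by (simp only: power_mult [symmetric] mult.assoc)
    then show ?thesis using i by (simp add: sieved_rho_def h)
  next
    case False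
    then obtain i where i: "k = 2 * i + 1" by (rule oddE)
    have "(int k - int N) div 2 = int (Suc i) - int (Suc h)" by (simp add: i h)
    moreover have "q powi (int (Suc i) - int (Suc h)) = q ^ Suc i / q ^ Suc h"
      using q0 power_int_diff[of q "int (Suc i)" "int (Suc h)"] by (simp only: power_int_of_nat) simp
    ultimately have "sieved_rho N q k = q ^ Suc i / q ^ Suc h"
      using False by (simp only: sieved_rho_def if_False)
    also have "\<dots> = q ^ (k * Suc h)"
    proof -
      have "q ^ (k * Suc h) * q ^ Suc h = q ^ (2 * (Suc i * Suc h))"
        unfolding power_add [symmetric] by (simp add: i algebra_simps)
      also have "\<dots> = q ^ Suc i" by (rule sq)
      finally show ?thesis using q0 by (simp add: field_simps del: mult_Suc_right mult_Suc)
    qed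
    also have "\<dots> = (q ^ k) ^ ((N + 1) div 2)"
      by (simp add: power_mult [symmetric] h power_add)
    finally show ?thesis .
  qed
qed

text \<open>
  Both parities of \<open>N\<close> are covered by one formula: for even \<open>N\<close> the sign \<open>(-1) ^ k\<close> is
  \<open>(q ^ k) ^ (N / 2)\<close>. The exponent of \<open>z\<close> in the second term is 2 for even and 1 for odd \<open>N\<close>.
\<close>

lemma sieved_A_uniform:
  assumes "N \<ge> 1" "primitive_unity_root N q"
  shows "sieved_A N q \<alpha> \<beta> k z =
    (of_real (\<alpha> + \<beta> + 1) * z\<^sup>2
      + of_real (\<alpha> - \<beta>) * (q ^ k) ^ ((N + 1) div 2) * z ^ (N + 2 - 2 * ((N + 1) div 2))) / (q ^ k - z\<^sup>2)"
proof (cases "even N")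
  case True
  then obtain h where h: "N = 2 * h" by (rule evenE)
  have "(q ^ h)\<^sup>2 = 1" "q ^ h \<noteq> 1"
    using assms h by (auto simp: primitive_unity_root_def power_mult [symmetric] mult.commute)
  then have "q ^ h = -1" by (simp add: power2_eq_1_iff)
  then have "(q ^ k) ^ h = (-1) ^ k" by (metis mult.commute power_mult)
  moreover have "complex_of_real (sieved_sigma \<alpha> \<beta> k) = of_real (\<alpha> + \<beta> + 1) + (-1) ^ k * of_real (\<alpha> - \<beta>)"
    by (simp add: sieved_sigma_def)
  ultimately show ?thesis using h
    by (simp add: sieved_A_def ring_distribs add_divide_distrib mult_ac del: of_real_add of_real_diff)
next
  case False
  then obtain h where h: "N = 2 * h + 1" by (rule oddE)
  show ?thesis
    using False assms sieved_rho_conv_power[of N q k]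
    by (simp add: sieved_A_def h primitive_unity_root_def mult_ac)
qed

text \<open>
  The two terms of \<open>A\<^sub>k\<close> contribute the partial fraction sums with exponents \<open>m\<close> and
  \<open>m + (N + 1) div 2\<close>. That sum is known for exponents between 1 and \<open>N\<close> only, so the second
  exponent is replaced by its representative \<open>l\<close> modulo \<open>N\<close> in this range. Whether a reduction takes
  place separates the two lemmas that follow, and with them the two forms of \<open>\<psi>\<close>.
\<close>

lemma sum_sieved_A_power:
  assumes N: "N \<ge> 1" and q: "primitive_unity_root N q"
    and z: "z \<noteq> 0" "\<forall>k<N. z\<^sup>2 \<noteq> q ^ k"
    and m: "1 \<le> m" "m \<le> N" and l: "1 \<le> l" "l \<le> N"
    and ml: "m + (N + 1) div 2 = l \<or> m + (N + 1) div 2 = N + l"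
  shows "(\<Sum>k<N. sieved_A N q \<alpha> \<beta> k z * (q ^ k) ^ m)
    = of_nat N * (of_real (\<alpha> + \<beta> + 1) * z ^ (2 * m)
        + of_real (\<alpha> - \<beta>) * z ^ (2 * l + N - 2 * ((N + 1) div 2))) / (1 - z ^ (2 * N))"
proof -
  define h where "h = (N + 1) div 2"
  define e where "e = N + 2 - 2 * h"
  have w: "z\<^sup>2 \<noteq> 0" using z by simp
  note S = sum_partial_fractions_primitive_root(2)[OF N q w z(2)]
  have ml': "(q ^ k) ^ h * (q ^ k) ^ m = (q ^ k) ^ l" for k
  proof -
    show ?thesis using ml power_primitive_root_power_eq_1[OF q, of k]
      by (auto simp: power_add [symmetric] h_def add.commute) (simp add: power_add)
  qed
  have "sieved_A N q \<alpha> \<beta> k z * (q ^ k) ^ m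
     = of_real (\<alpha> + \<beta> + 1) * z\<^sup>2 * ((q ^ k) ^ m / (q ^ k - z\<^sup>2))
       + of_real (\<alpha> - \<beta>) * z ^ e * ((q ^ k) ^ l / (q ^ k - z\<^sup>2))" for k
    unfolding sieved_A_uniform[OF N q] h_def[symmetric] e_def[symmetric] ml'[symmetric]
    by (simp add: add_divide_distrib ring_distribs mult_ac del: of_real_add of_real_diff)
  then have "(\<Sum>k<N. sieved_A N q \<alpha> \<beta> k z * (q ^ k) ^ m)
     = of_real (\<alpha> + \<beta> + 1) * z\<^sup>2 * (\<Sum>k<N. (q ^ k) ^ m / (q ^ k - z\<^sup>2))
       + of_real (\<alpha> - \<beta>) * z ^ e * (\<Sum>k<N. (q ^ k) ^ l / (q ^ k - z\<^sup>2))"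
    by (simp add: sum.distrib sum_distrib_left)
  also have "\<dots> = of_nat N * (of_real (\<alpha> + \<beta> + 1) * (z\<^sup>2 * (z\<^sup>2) ^ (m - 1))
        + of_real (\<alpha> - \<beta>) * (z ^ e * (z\<^sup>2) ^ (l - 1))) / (1 - (z\<^sup>2) ^ N)"
    unfolding S[OF m, simplified] S[OF l, simplified]
    by (simp add: add_divide_distrib distrib_left mult_ac del: of_real_add of_real_diff)
  also have "z\<^sup>2 * (z\<^sup>2) ^ (m - 1) = z ^ (2 * m)"
    using m(1) by (simp add: power_Suc [symmetric] power_mult del: power_Suc)
  also have "z ^ e * (z\<^sup>2) ^ (l - 1) = z ^ (e + 2 * (l - 1))"
    by (simp add: power_add power_mult)
  also have "e + 2 * (l - 1) = 2 * l + N - 2 * h"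
  proof -
    have "2 * h \<le> N + 1" by (simp add: h_def)
    then show ?thesis using l(1) by (simp add: e_def)
  qed
  finally show ?thesis by (simp add: h_def power_mult)
qed

lemma sum_sieved_A_power_low:
  assumes N: "N \<ge> 1" and q: "primitive_unity_root N q"
    and z: "z \<noteq> 0" "\<forall>k<N. z\<^sup>2 \<noteq> q ^ k"
    and c: "1 \<le> c" "2 * c \<le> N"
  shows "(\<Sum>k<N. sieved_A N q \<alpha> \<beta> k z * (q ^ k) ^ c)
    = of_nat N * z ^ (2 * c) * (of_real (\<alpha> + \<beta> + 1) + of_real (\<alpha> - \<beta>) * z ^ N) / (1 - (z ^ N)\<^sup>2)"
proof -
  have "2 * (c + (N + 1) div 2) + N - 2 * ((N + 1) div 2) = 2 * c + N" by simp
  moreover have "c + (N + 1) div 2 \<le> N" using c by presburger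
  moreover have "z ^ (2 * N) = (z ^ N)\<^sup>2" by (simp add: power_mult [symmetric] mult.commute)
  ultimately show ?thesis
    using sum_sieved_A_power[OF N q z, of c "c + (N + 1) div 2"] c
    by (simp add: power_add algebra_simps)
qed

lemma sum_sieved_A_power_high:
  assumes N: "N \<ge> 1" and q: "primitive_unity_root N q"
    and z: "z \<noteq> 0" "\<forall>k<N. z\<^sup>2 \<noteq> q ^ k"
    and c: "2 * c < N"
  shows "(\<Sum>k<N. sieved_A N q \<alpha> \<beta> k z * (q ^ k) ^ (N - c))
    = of_nat N / z ^ (2 * c)
       * (of_real (\<alpha> + \<beta> + 1) * (z ^ N)\<^sup>2 + of_real (\<alpha> - \<beta>) * z ^ N) / (1 - (z ^ N)\<^sup>2)"
proof -
  \<comment> \<open>The exponent N - c + (N + 1) div 2 is N + l, and the bound on c makes l positive.\<close>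
  define l where "l = (N + 1) div 2 - c"
  have l: "1 \<le> l" "l \<le> N" "N - c + (N + 1) div 2 = N + l" "2 * l + N - 2 * ((N + 1) div 2) = N - 2 * c"
    using c unfolding l_def by presburger+
  have e: "z ^ (2 * N) = (z ^ N)\<^sup>2" by (simp add: power_mult [symmetric] mult.commute)
  have p: "z ^ (2 * (N - c)) = (z ^ N)\<^sup>2 / z ^ (2 * c)" "z ^ (N - 2 * c) = z ^ N / z ^ (2 * c)"
    using z(1) c by (simp_all add: e [symmetric] power_diff diff_mult_distrib2)
  define s d where "s = complex_of_real (\<alpha> + \<beta> + 1)" and "d = complex_of_real (\<alpha> - \<beta>)"
  have "(\<Sum>k<N. sieved_A N q \<alpha> \<beta> k z * (q ^ k) ^ (N - c))
    = of_nat N * (s * ((z ^ N)\<^sup>2 / z ^ (2 * c)) + d * (z ^ N / z ^ (2 * c))) / (1 - (z ^ N)\<^sup>2)"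
    using sum_sieved_A_power[OF N q z, of "N - c" l \<alpha> \<beta>] c l(1,2,3)
    unfolding l(4) p e s_def d_def by simp
  also have "s * ((z ^ N)\<^sup>2 / z ^ (2 * c)) + d * (z ^ N / z ^ (2 * c))
    = (s * (z ^ N)\<^sup>2 + d * z ^ N) / z ^ (2 * c)"
    by (simp add: add_divide_distrib)
  finally show ?thesis by (simp add: s_def d_def)
qed

section \<open>The operator on functions pulled back along the N-th power\<close>

lemma sieved_L_1:
  assumes "(g has_field_derivative g') (at w)"
  shows "sieved_L 1 1 \<alpha> \<beta> g w = w * g'
    + (of_real (\<alpha> + \<beta> + 1) * w\<^sup>2 + of_real (\<alpha> - \<beta>) * w) / (1 - w\<^sup>2) * (g (1 / w) - g w)"
  using DERIV_imp_deriv[OF assms]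
  by (simp add: sieved_L_def sieved_A_def sieved_rho_def refl_op_def)

text \<open>
  A reflection sends \<open>g (z ^ N) / z ^ c\<close> to \<open>(q ^ k) ^ (N - c) z ^ c g (1 / z ^ N)\<close>, so the
  reflected and the unreflected part are governed by \<open>sum_sieved_A_power_high\<close> at \<open>c\<close> and at 0.
  Both sums produce the coefficient \<open>A\<close> of \<open>L(1)\<close>, the first with a factor \<open>1 / z ^ (2 * c)\<close> that
  turns \<open>z ^ c\<close> back into \<open>1 / z ^ c\<close>.
\<close>

lemma sieved_L_pullback:
  assumes N: "N \<ge> 1" and q: "primitive_unity_root N q"
    and z: "z \<noteq> 0" "\<forall>k<N. z\<^sup>2 \<noteq> q ^ k"
    and c: "2 * c < N"
    and f: "\<And>z. z \<noteq> 0 \<Longrightarrow> f z = g (z ^ N) / z ^ c"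
    and g: "g field_differentiable (at (z ^ N))"
  shows "sieved_L N q \<alpha> \<beta> f z
    = (of_nat N * sieved_L 1 1 \<alpha> \<beta> g (z ^ N) - of_nat c * g (z ^ N)) / z ^ c"
proof -
  define Z where "Z = z ^ N"
  define A where "A = (of_real (\<alpha> + \<beta> + 1) * Z\<^sup>2 + of_real (\<alpha> - \<beta>) * Z) / (1 - Z\<^sup>2)"
  obtain g' where g': "(g has_field_derivative g') (at (z ^ N))"
    using g by (auto simp: field_differentiable_def)
  have qk: "q ^ k \<noteq> 0" "(q ^ k) ^ N = 1" for k
    using primitive_unity_root_nonzero[OF N q] power_primitive_root_power_eq_1[OF q] by simp_all
  have "((\<lambda>z. g (z ^ N)) has_field_derivative g' * (of_nat N * z ^ (N - 1))) (at z)"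
    by (rule DERIV_chain2[where f = g and g = "\<lambda>z. z ^ N", OF g']) (auto intro!: derivative_eq_intros)
  then have "((\<lambda>z. g (z ^ N) / z ^ c) has_field_derivative
      (of_nat N * (z ^ N * g') - of_nat c * g (z ^ N)) / (z * z ^ c)) (at z)"
  proof (rule DERIV_cong[OF DERIV_divide])
    show "((\<lambda>z. z ^ c) has_field_derivative of_nat c * z ^ (c - 1)) (at z)"
      by (auto intro!: derivative_eq_intros)
    show "z ^ c \<noteq> 0" using z by simp
    show "(g' * (of_nat N * z ^ (N - 1)) * z ^ c - g (z ^ N) * (of_nat c * z ^ (c - 1))) / (z ^ c * z ^ c)
        = (of_nat N * (z ^ N * g') - of_nat c * g (z ^ N)) / (z * z ^ c)"
      using z(1) N by (cases N; cases c) (simp_all add: field_simps)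
  qed
  then have "(f has_field_derivative (of_nat N * (z ^ N * g') - of_nat c * g (z ^ N)) / (z * z ^ c)) (at z)"
    by (rule has_field_derivative_transform_within_open[where S = "- {0}"]) (use z f in auto)
  then have D: "z * deriv f z = (of_nat N * (Z * g') - of_nat c * g Z) / z ^ c"
    using z(1) by (simp add: DERIV_imp_deriv Z_def)
  have R: "refl_op q k f z = (q ^ k) ^ (N - c) * (z ^ c * g (1 / Z))" for k
  proof -
    have "refl_op q k f z = g ((q ^ k / z) ^ N) / (q ^ k / z) ^ c"
      using qk z by (simp add: refl_op_def f)
    also have "(q ^ k / z) ^ N = 1 / Z" by (simp add: power_divide qk Z_def)
    also have "g (1 / Z) / (q ^ k / z) ^ c = (q ^ k) ^ (N - c) * (z ^ c * g (1 / Z))"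
      using qk c z by (simp add: power_diff power_divide field_simps)
    finally show ?thesis .
  qed
  \<comment> \<open>Writing the factor 1 as (q ^ k) ^ N puts the unreflected part into the form of the known sums.\<close>
  have "(\<Sum>k<N. sieved_A N q \<alpha> \<beta> k z * (refl_op q k f z - f z))
      = (\<Sum>k<N. sieved_A N q \<alpha> \<beta> k z * (q ^ k) ^ (N - c)) * (z ^ c * g (1 / Z))
        - (\<Sum>k<N. sieved_A N q \<alpha> \<beta> k z * (q ^ k) ^ (N - 0)) * (g Z / z ^ c)"
    unfolding R f[OF z(1)]
    by (simp add: qk Z_def right_diff_distrib sum_subtractf sum_distrib_left sum_distrib_right
        sum_divide_distrib mult_ac del: of_real_add of_real_diff)
  also have "\<dots> = of_nat N / z ^ (2 * c) * A * (z ^ c * g (1 / Z)) - of_nat N * A * (g Z / z ^ c)"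
    unfolding sum_sieved_A_power_high[OF N q z c]
    using sum_sieved_A_power_high[OF N q z, of 0] N
    by (simp add: A_def Z_def)
  also have "\<dots> = of_nat N * A * (g (1 / Z) - g Z) / z ^ c"
    using z(1) unfolding mult_2 power_add by (simp add: field_simps)
  finally have "sieved_L N q \<alpha> \<beta> f z
      = (of_nat N * (Z * g') - of_nat c * g Z) / z ^ c + of_nat N * A * (g (1 / Z) - g Z) / z ^ c"
    unfolding sieved_L_def[of N] D by simp
  also have "\<dots> = (of_nat N * (Z * g' + A * (g (1 / Z) - g Z)) - of_nat c * g Z) / z ^ c"
    by (simp add: add_divide_distrib diff_divide_distrib ring_distribs mult_ac)
  also have "Z * g' + A * (g (1 / Z) - g Z) = sieved_L 1 1 \<alpha> \<beta> g Z"
    using sieved_L_1[OF g', of \<alpha> \<beta>] by (simp only: Z_def A_def)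
  finally show ?thesis by (simp only: Z_def)
qed

text \<open>
  The reflected part now carries the coefficient \<open>(s + d Z) / (1 - Z\<^sup>2)\<close> and the unreflected
  part \<open>(s Z\<^sup>2 + d Z) / (1 - Z\<^sup>2)\<close>, where \<open>Z = z ^ N\<close>, \<open>s = \<alpha> + \<beta> + 1\<close> and
  \<open>d = \<alpha> - \<beta>\<close>. The substitution \<open>Z \<mapsto> 1 / Z\<close> exchanges these two up to sign, and their difference is \<open>s\<close>; this is the origin of
  \<open>s g - L(1) g\<close>.
\<close>

lemma sieved_L_pullback_inverse:
  assumes N: "N \<ge> 1" and q: "primitive_unity_root N q"
    and z: "z \<noteq> 0" "\<forall>k<N. z\<^sup>2 \<noteq> q ^ k"
    and c: "1 \<le> c" "2 * c \<le> N"
    and f: "\<And>z. z \<noteq> 0 \<Longrightarrow> f z = z ^ c * g (1 / z ^ N)"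
    and g: "g field_differentiable (at (1 / z ^ N))"
  shows "sieved_L N q \<alpha> \<beta> f z
    = z ^ c * (of_nat c * g (1 / z ^ N)
        + of_nat N * (of_real (\<alpha> + \<beta> + 1) * g (1 / z ^ N) - sieved_L 1 1 \<alpha> \<beta> g (1 / z ^ N)))"
proof -
  define Z where "Z = z ^ N"
  define s d where "s = complex_of_real (\<alpha> + \<beta> + 1)" and "d = complex_of_real (\<alpha> - \<beta>)"
  have Z0: "Z \<noteq> 0" using z by (simp add: Z_def)
  have "(z\<^sup>2) ^ N \<noteq> 1"
    using sum_partial_fractions_primitive_root(1)[OF N q _ z(2), of 1] z(1) N by simp
  then have Z1: "1 - Z\<^sup>2 \<noteq> 0"
    by (simp add: Z_def power_mult [symmetric] mult.commute)
  obtain g' where g': "(g has_field_derivative g') (at (1 / z ^ N))"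
    using g by (auto simp: field_differentiable_def)
  have qk: "q ^ k \<noteq> 0" "(q ^ k) ^ N = 1" for k
    using primitive_unity_root_nonzero[OF N q] power_primitive_root_power_eq_1[OF q] by simp_all
  have "((\<lambda>z. g (1 / z ^ N)) has_field_derivative g' * (- of_nat N / (z * z ^ N))) (at z)"
  proof (rule DERIV_chain2[where f = g and g = "\<lambda>z. 1 / z ^ N", OF g'])
    show "((\<lambda>z. 1 / z ^ N) has_field_derivative - of_nat N / (z * z ^ N)) (at z)"
    proof (rule DERIV_cong[OF DERIV_divide[OF DERIV_const]])
      show "((\<lambda>z. z ^ N) has_field_derivative of_nat N * z ^ (N - 1)) (at z)"
        by (auto intro!: derivative_eq_intros)
      show "z ^ N \<noteq> 0" using z by simp
      show "(0 * z ^ N - 1 * (of_nat N * z ^ (N - 1))) / (z ^ N * z ^ N) = - of_nat N / (z * z ^ N)"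
        using z(1) by (cases N) (simp_all add: field_simps)
    qed
  qed
  then have "((\<lambda>z. z ^ c * g (1 / z ^ N)) has_field_derivative
      z ^ c * (of_nat c * g (1 / z ^ N) - of_nat N * g' / z ^ N) / z) (at z)"
  proof (rule DERIV_cong[OF DERIV_mult, rotated])
    show "((\<lambda>z. z ^ c) has_field_derivative of_nat c * z ^ (c - 1)) (at z)"
      by (auto intro!: derivative_eq_intros)
    show "of_nat c * z ^ (c - 1) * g (1 / z ^ N) + g' * (- of_nat N / (z * z ^ N)) * z ^ c
        = z ^ c * (of_nat c * g (1 / z ^ N) - of_nat N * g' / z ^ N) / z"
      using z(1) by (cases c) (simp_all add: field_simps)
  qed
  then have "(f has_field_derivative z ^ c * (of_nat c * g (1 / z ^ N) - of_nat N * g' / z ^ N) / z) (at z)"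
    by (rule has_field_derivative_transform_within_open[where S = "- {0}"]) (use z f in auto)
  then have D: "z * deriv f z = z ^ c * (of_nat c * g (1 / Z) - of_nat N * g' / Z)"
    using z(1) by (simp add: DERIV_imp_deriv Z_def)
  have R: "refl_op q k f z = (q ^ k) ^ c * (g Z / z ^ c)" for k
  proof -
    have "refl_op q k f z = (q ^ k / z) ^ c * g (1 / (q ^ k / z) ^ N)"
      using qk z by (simp add: refl_op_def f)
    also have "1 / (q ^ k / z) ^ N = Z" by (simp add: power_divide qk Z_def)
    finally show ?thesis by (simp add: power_divide)
  qed
  \<comment> \<open>Writing the factor 1 as (q ^ k) ^ N puts the unreflected part into the form of the known sums.\<close>
  have "(\<Sum>k<N. sieved_A N q \<alpha> \<beta> k z * (refl_op q k f z - f z))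
      = (\<Sum>k<N. sieved_A N q \<alpha> \<beta> k z * (q ^ k) ^ c) * (g Z / z ^ c)
        - (\<Sum>k<N. sieved_A N q \<alpha> \<beta> k z * (q ^ k) ^ (N - 0)) * (z ^ c * g (1 / Z))"
    unfolding R f[OF z(1)]
    by (simp add: qk Z_def right_diff_distrib sum_subtractf sum_distrib_left sum_distrib_right
        sum_divide_distrib mult_ac del: of_real_add of_real_diff)
  also have "\<dots> = of_nat N * z ^ (2 * c) * ((s + d * Z) / (1 - Z\<^sup>2)) * (g Z / z ^ c)
        - of_nat N * ((s * Z\<^sup>2 + d * Z) / (1 - Z\<^sup>2)) * (z ^ c * g (1 / Z))"
    unfolding sum_sieved_A_power_low[OF N q z c]
    using sum_sieved_A_power_high[OF N q z, of 0] N
    by (simp add: s_def d_def Z_def)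
  also have "\<dots> = z ^ c * (of_nat N * ((s + d * Z) * g Z - (s * Z\<^sup>2 + d * Z) * g (1 / Z)) / (1 - Z\<^sup>2))"
    using z(1) unfolding mult_2 power_add by (simp add: diff_divide_distrib algebra_simps)
  finally have L: "sieved_L N q \<alpha> \<beta> f z = z ^ c * (of_nat c * g (1 / Z) + of_nat N *
      (((s + d * Z) * g Z - (s * Z\<^sup>2 + d * Z) * g (1 / Z)) / (1 - Z\<^sup>2) - g' / Z))"
    unfolding sieved_L_def[of N] D by (simp add: algebra_simps)
  have Z1': "1 - (1 / Z)\<^sup>2 \<noteq> 0" using Z1 Z0 by (simp add: field_simps)
  have A: "(s * (1 / Z)\<^sup>2 + d * (1 / Z)) / (1 - (1 / Z)\<^sup>2) = - (s + d * Z) / (1 - Z\<^sup>2)"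
    using Z1 Z1' Z0 by (simp add: frac_eq_eq) (simp add: field_simps power2_eq_square)
  have "sieved_L 1 1 \<alpha> \<beta> g (1 / Z) = 1 / Z * g' + - (s + d * Z) / (1 - Z\<^sup>2) * (g Z - g (1 / Z))"
    using sieved_L_1[OF g', of \<alpha> \<beta>] unfolding Z_def[symmetric] s_def[symmetric] d_def[symmetric] A
    by simp
  then have "s * g (1 / Z) - sieved_L 1 1 \<alpha> \<beta> g (1 / Z)
      = ((s + d * Z) * g Z - (s * Z\<^sup>2 + d * Z) * g (1 / Z)) / (1 - Z\<^sup>2) - g' / Z"
    using Z1 Z0 by (simp add: divide_simps) (simp add: algebra_simps power2_eq_square)
  then show ?thesis unfolding L by (simp add: Z_def s_def)
qed

section \<open>Szego recurrence and sieving\<close>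

lemma coeff_reversed_poly:
  "coeff (reversed_poly n p) i = (if i \<le> n then coeff p (n - i) else 0)"
  unfolding reversed_poly_def by (simp add: coeff_sum)

text \<open>
  Reversal is an involution on polynomials of degree at most \<open>n\<close> and makes the factor \<open>z\<close> disappear,
  which gives the second half of the Szego recurrence.
\<close>

lemma reversed_poly_Szego_step:
  assumes "degree p \<le> n"
  shows "reversed_poly (Suc n) ([:0, 1:] * p - smult a (reversed_poly n p))
    = reversed_poly n p - smult a ([:0, 1:] * p)"
proof (rule poly_eqI)
  fix i
  show "coeff (reversed_poly (Suc n) ([:0, 1:] * p - smult a (reversed_poly n p))) i
      = coeff (reversed_poly n p - smult a ([:0, 1:] * p)) i"
    using assms
    by (cases i) (auto simp: coeff_reversed_poly coeff_pCons coeff_eq_0 Suc_diff_le split: nat.splits,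
        rule arg_cong[of _ _ "coeff p"], linarith)
qed

lemma reversed_poly_0_1 [simp]: "reversed_poly 0 1 = 1"
  by (simp add: reversed_poly_def monom_0)

abbreviation sieved_Phi_rev :: "nat \<Rightarrow> real \<Rightarrow> real \<Rightarrow> nat \<Rightarrow> complex poly" where
  "sieved_Phi_rev N \<alpha> \<beta> n \<equiv> reversed_poly n (sieved_Phi N \<alpha> \<beta> n)"

lemma sieved_Phi_rev_Suc:
  "sieved_Phi_rev N \<alpha> \<beta> (Suc n) = sieved_Phi_rev N \<alpha> \<beta> n
     - smult (of_real (sieved_verblunsky N \<alpha> \<beta> n)) ([:0, 1:] * sieved_Phi N \<alpha> \<beta> n)"
  using sieved_Phi_monic[of N \<alpha> \<beta> n] by (simp add: reversed_poly_Szego_step del: mult_pCons_left)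

text \<open>
  Between two indices at which the parameter is nonzero, \<open>\<Phi>\<close> only collects factors \<open>z\<close>, and
  \<open>\<Phi>\<^sup>*\<close> is constant. After \<open>N\<close> steps this amounts to one unsieved step in the variable
  \<open>z ^ N\<close>. The two claims need a joint induction.
\<close>

lemma sieved_Phi_conv_jacobi:
  assumes "N \<ge> 1"
  shows "poly (sieved_Phi N \<alpha> \<beta> n) z = z ^ (n mod N) * poly (sieved_Phi 1 \<alpha> \<beta> (n div N)) (z ^ N)
    \<and> poly (sieved_Phi_rev N \<alpha> \<beta> n) z = poly (sieved_Phi_rev 1 \<alpha> \<beta> (n div N)) (z ^ N)"
proof (induction n)
  case 0
  show ?case by simp
next
  case (Suc n)
  have v1: "sieved_verblunsky 1 \<alpha> \<beta> m = jacobi_verblunsky \<alpha> \<beta> m" for m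
    by (simp add: sieved_verblunsky_def)
  show ?case
  proof (cases "N dvd Suc n")
    case True
    then have k: "Suc n div N = Suc (n div N)" "Suc n mod N = 0"
      using assms by (simp_all add: div_Suc dvd_eq_mod_eq_0)
    then have j: "Suc (n mod N) = N" using assms by (simp add: mod_Suc split: if_splits)
    have "sieved_verblunsky N \<alpha> \<beta> n = jacobi_verblunsky \<alpha> \<beta> (n div N)"
      using True k by (simp add: sieved_verblunsky_def)
    moreover have "z * (z ^ (n mod N) * x) = z ^ N * x" for x
      by (metis j mult.assoc power_Suc)
    ultimately show ?thesis
      unfolding k sieved_Phi_rev_Suc using Suc
      by (simp add: v1 sieved_Phi_rev_Suc del: One_nat_def)
  next
    case False
    then have k: "Suc n div N = n div N" "Suc n mod N = Suc (n mod N)"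
      by (auto simp: div_Suc mod_Suc dvd_eq_mod_eq_0)
    have "sieved_verblunsky N \<alpha> \<beta> n = 0" using False by (simp add: sieved_verblunsky_def)
    then show ?thesis
      unfolding k sieved_Phi_rev_Suc using Suc by simp
  qed
qed

section \<open>The unsieved Jacobi polynomials\<close>

text \<open>
  For even \<open>n\<close> the equation for \<open>Q\<close>, and for odd \<open>n\<close> the equation for \<open>P\<close>, is the eigenvalue
  equation of \<open>\<psi>\<close> cleared of denominators; the other one is its reversal. In the induction step the
  two sides differ by a multiple of \<open>d + a (n + 1 + s)\<close> for even and of \<open>s + a (n + 1 + s)\<close> for odd
  \<open>n\<close>, where \<open>a\<close> is the Verblunsky parameter of index \<open>n\<close>; its value makes this factor zero. A direct
  induction works for all parameters, including those for which eigenvalues of \<open>L(1)\<close> coincide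
  and do not determine the eigenfunctions.
\<close>

lemma jacobi_Phi_differential_system:
  fixes \<alpha> \<beta> :: real and z :: complex and n :: nat
  assumes "\<alpha> > -1" "\<beta> > -1"
  defines "s \<equiv> complex_of_real (\<alpha> + \<beta> + 1)" and "d \<equiv> complex_of_real (\<alpha> - \<beta>)"
  defines "P \<equiv> \<lambda>n. sieved_Phi 1 \<alpha> \<beta> n" and "Q \<equiv> \<lambda>n. sieved_Phi_rev 1 \<alpha> \<beta> n"
  defines "D \<equiv> \<lambda>p. z * (1 - z\<^sup>2) * poly (pderiv p) z"
  shows "if even n
    then D (P n) = of_nat n * (1 - z\<^sup>2) * poly (P n) z + (s + d * z) * (poly (P n) z - poly (Q n) z)
       \<and> D (Q n) = - (s * z\<^sup>2 + d * z) * (poly (P n) z - poly (Q n) z)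
    else D (P n) = (of_nat n + s) * (1 - z\<^sup>2) * poly (P n) z + (s * z\<^sup>2 + d * z) * poly (P n) z
                     - (s * z + d) * poly (Q n) z
       \<and> D (Q n) = (s * z\<^sup>2 + d * z) * poly (Q n) z - (s * z + d * z\<^sup>2) * poly (P n) z"
proof (induction n)
  case 0
  show ?case by (simp add: P_def Q_def D_def)
next
  case (Suc n)
  define a where "a = complex_of_real (jacobi_verblunsky \<alpha> \<beta> n)"
  have v: "sieved_verblunsky 1 \<alpha> \<beta> n = jacobi_verblunsky \<alpha> \<beta> n"
    by (simp add: sieved_verblunsky_def)
  have P: "P (Suc n) = [:0, 1:] * P n - smult a (Q n)"
    by (simp only: P_def Q_def a_def v sieved_Phi.simps)
  have Q: "Q (Suc n) = Q n - smult a ([:0, 1:] * P n)"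
    by (simp only: P_def Q_def a_def v sieved_Phi_rev_Suc)
  define p r p' r' where "p = poly (P n) z" and "r = poly (Q n) z"
    and "p' = D (P n)" and "r' = D (Q n)"
  have pS: "poly (P (Suc n)) z = z * p - a * r" "poly (Q (Suc n)) z = r - a * z * p"
    "D (P (Suc n)) = z * (1 - z\<^sup>2) * p + z * p' - a * r'"
    "D (Q (Suc n)) = r' - a * (z * (1 - z\<^sup>2) * p + z * p')"
    by (simp_all add: P Q p_def r_def p'_def r'_def D_def pderiv_pCons pderiv_diff pderiv_smult
        algebra_simps)
  have den: "real n + \<alpha> + \<beta> + 2 \<noteq> 0" using assms(1,2) by linarith
  show ?case
  proof (cases "even n")
    case True
    have "jacobi_verblunsky \<alpha> \<beta> n * (real n + \<alpha> + \<beta> + 2) = - (\<alpha> - \<beta>)"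
      using True den by (simp add: jacobi_verblunsky_def)
    then have "\<alpha> - \<beta> = - jacobi_verblunsky \<alpha> \<beta> n * (real n + 1 + (\<alpha> + \<beta> + 1))"
      by algebra
    then have "d = complex_of_real (- jacobi_verblunsky \<alpha> \<beta> n * (real n + 1 + (\<alpha> + \<beta> + 1)))"
      unfolding d_def by (rule arg_cong)
    also have "\<dots> = - a * (of_nat n + 1 + s)" by (simp add: a_def s_def)
    finally have d: "d = - a * (of_nat n + 1 + s)" .
    have p': "p' = of_nat n * (1 - z\<^sup>2) * p + (s + d * z) * (p - r)"
      and r': "r' = - (s * z\<^sup>2 + d * z) * (p - r)"
      using Suc True by (simp_all add: p_def r_def p'_def r'_def)
    have "z * (1 - z\<^sup>2) * p + z * p' - a * r'
        = (of_nat n + 1 + s) * (1 - z\<^sup>2) * (z * p - a * r) + (s * z\<^sup>2 + d * z) * (z * p - a * r)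
          - (s * z + d) * (r - a * z * p)"
      using d unfolding p' r' by algebra
    moreover have "r' - a * (z * (1 - z\<^sup>2) * p + z * p')
        = (s * z\<^sup>2 + d * z) * (r - a * z * p) - (s * z + d * z\<^sup>2) * (z * p - a * r)"
      using d unfolding p' r' by algebra
    ultimately show ?thesis using True by (simp add: pS add_ac)
  next
    case False
    have "jacobi_verblunsky \<alpha> \<beta> n * (real n + \<alpha> + \<beta> + 2) = - (\<alpha> + \<beta> + 1)"
      using False den by (simp add: jacobi_verblunsky_def)
    then have "\<alpha> + \<beta> + 1 = - jacobi_verblunsky \<alpha> \<beta> n * (real n + 1 + (\<alpha> + \<beta> + 1))"
      by algebra
    then have "s = complex_of_real (- jacobi_verblunsky \<alpha> \<beta> n * (real n + 1 + (\<alpha> + \<beta> + 1)))"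
      unfolding s_def by (rule arg_cong)
    also have "\<dots> = - a * (of_nat n + 1 + s)" by (simp add: a_def s_def)
    finally have s: "s = - a * (of_nat n + 1 + s)" .
    have p': "p' = (of_nat n + s) * (1 - z\<^sup>2) * p + (s * z\<^sup>2 + d * z) * p - (s * z + d) * r"
      and r': "r' = (s * z\<^sup>2 + d * z) * r - (s * z + d * z\<^sup>2) * p"
      using Suc False by (simp_all add: p_def r_def p'_def r'_def)
    have "z * (1 - z\<^sup>2) * p + z * p' - a * r'
        = (of_nat n + 1) * (1 - z\<^sup>2) * (z * p - a * r) + (s + d * z) * ((z * p - a * r) - (r - a * z * p))"
      using s unfolding p' r' by algebra
    moreover have "r' - a * (z * (1 - z\<^sup>2) * p + z * p')
        = - (s * z\<^sup>2 + d * z) * ((z * p - a * r) - (r - a * z * p))"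
      using s unfolding p' r' by algebra
    ultimately show ?thesis using False by (simp add: pS add_ac)
  qed
qed

text \<open>
  In both parities \<open>\<psi> = F / z ^ (n div 2)\<close> and \<open>\<psi> (1 / z) = G / z ^ ((n + 1) div 2)\<close>, where
  \<open>(F, G)\<close> is \<open>(\<Phi>\<^sup>*, \<Phi>)\<close> for even and \<open>(\<Phi>, \<Phi>\<^sup>*)\<close> for odd \<open>n\<close>; the differential
  system provides the derivative of \<open>F\<close>.
\<close>

lemma sieved_L_jacobi_psi:
  assumes \<alpha>\<beta>: "\<alpha> > -1" "\<beta> > -1" and z: "z \<noteq> 0" "z\<^sup>2 \<noteq> 1"
  shows "cmv_psi 1 \<alpha> \<beta> n field_differentiable (at z)"
    and "sieved_L 1 1 \<alpha> \<beta> (cmv_psi 1 \<alpha> \<beta> n) z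
      = of_real (sieved_lambda 1 \<alpha> \<beta> n) * cmv_psi 1 \<alpha> \<beta> n z"
proof -
  define s d where "s = complex_of_real (\<alpha> + \<beta> + 1)" and "d = complex_of_real (\<alpha> - \<beta>)"
  define P where "P = sieved_Phi 1 \<alpha> \<beta> n"
  define Q where "Q = sieved_Phi_rev 1 \<alpha> \<beta> n"
  define m where "m = n div 2"
  define g where "g = cmv_psi 1 \<alpha> \<beta> n"
  have deg: "degree P \<le> n" using sieved_Phi_monic[of 1 \<alpha> \<beta> n] by (simp add: P_def)
  have rev: "poly Q w = w ^ n * poly P (1 / w)" if "w \<noteq> 0" for w
    using poly_reversed_poly[OF deg that] by (simp add: P_def Q_def)
  have rev': "poly Q (1 / w) = poly P w / w ^ n" if "w \<noteq> 0" for w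
    using rev[of "1 / w"] that by (simp add: power_divide)
  define B where "B = 1 - z\<^sup>2"
  have B: "B \<noteq> 0" using z by (simp add: B_def)
  note sys = jacobi_Phi_differential_system[OF \<alpha>\<beta>, of n z, folded s_def d_def P_def Q_def B_def]
  have "g field_differentiable (at z) \<and> sieved_L 1 1 \<alpha> \<beta> g z = of_real (sieved_lambda 1 \<alpha> \<beta> n) * g z"
  proof (cases "even n")
    case True
    then have n: "n = 2 * m" by (simp add: m_def)
    have g: "g w = poly Q w / w ^ m" if "w \<noteq> 0" for w
      using that True unfolding g_def cmv_psi_def P_def[symmetric]
      by (simp add: rev n mult_2 power_add)
    have g1: "g (1 / z) = poly P z / z ^ m"
      using z rev'[of z] by (simp add: g power_divide n mult_2 power_add)
    have "((\<lambda>w. poly Q w / w ^ m) has_field_derivative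
        (z * poly (pderiv Q) z - of_nat m * poly Q z) / (z * z ^ m)) (at z)"
      using z(1)
      apply -
      apply (rule derivative_eq_intros refl | simp)+
      apply (cases m)
      apply (simp_all add: field_simps)
      done
    then have D: "(g has_field_derivative (z * poly (pderiv Q) z - of_nat m * poly Q z) / (z * z ^ m)) (at z)"
      by (rule has_field_derivative_transform_within_open[where S = "- {0}"]) (use z g in auto)
    have "z * B * poly (pderiv Q) z = - (s * z\<^sup>2 + d * z) * (poly P z - poly Q z)"
      using sys True by simp
    then have E: "z * poly (pderiv Q) z = (s * z\<^sup>2 + d * z) / B * (poly Q z - poly P z)"
      using B by (simp add: field_simps)
    have "sieved_L 1 1 \<alpha> \<beta> g z = - of_nat m * g z"
      unfolding sieved_L_1[OF D] s_def[symmetric] d_def[symmetric] B_def[symmetric] g1 g[OF z(1)] E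
      using z(1) by (simp add: diff_divide_distrib right_diff_distrib)
    moreover have "sieved_lambda 1 \<alpha> \<beta> n = - real m" using True n by (simp add: sieved_lambda_def)
    ultimately show ?thesis using D by (auto simp: field_differentiable_def)
  next
    case False
    then have n: "n = 2 * m + 1" by (simp add: m_def)
    have g: "g w = poly P w / w ^ m" if "w \<noteq> 0" for w
      using that False unfolding g_def cmv_psi_def P_def[symmetric]
      by (simp add: m_def power_int_minus field_simps)
    have g1: "g (1 / z) = poly Q z / (z * z ^ m)"
      using z by (simp add: g rev power_divide n mult_2 power_add)
    have "((\<lambda>w. poly P w / w ^ m) has_field_derivative
        (z * poly (pderiv P) z - of_nat m * poly P z) / (z * z ^ m)) (at z)"
      using z(1)
      apply -
      apply (rule derivative_eq_intros refl | simp)+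
      apply (cases m)
      apply (simp_all add: field_simps)
      done
    then have D: "(g has_field_derivative (z * poly (pderiv P) z - of_nat m * poly P z) / (z * z ^ m)) (at z)"
      by (rule has_field_derivative_transform_within_open[where S = "- {0}"]) (use z g in auto)
    have "z * B * poly (pderiv P) z
        = (of_nat n + s) * B * poly P z + (s * z\<^sup>2 + d * z) * poly P z - (s * z + d) * poly Q z"
      using sys False by simp
    moreover have "(s * z\<^sup>2 + d * z) * (poly P z - poly Q z / z)
        = (s * z\<^sup>2 + d * z) * poly P z - (s * z + d) * poly Q z"
      using z(1) by (simp add: field_simps power2_eq_square)
    ultimately have "z * B * poly (pderiv P) z
        = (of_nat n + s) * B * poly P z + (s * z\<^sup>2 + d * z) * (poly P z - poly Q z / z)"
      by simp
    then have "z * poly (pderiv P) z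
        = ((of_nat n + s) * B * poly P z + (s * z\<^sup>2 + d * z) * (poly P z - poly Q z / z)) / B"
      using B by (simp add: eq_divide_eq mult_ac)
    then have E: "z * poly (pderiv P) z
        = (of_nat n + s) * poly P z + (s * z\<^sup>2 + d * z) / B * (poly P z - poly Q z / z)"
      using B by (simp add: add_divide_distrib [of "(of_nat n + s) * B * poly P z"])
    have "sieved_L 1 1 \<alpha> \<beta> g z = (of_nat n - of_nat m + s) * g z"
      unfolding sieved_L_1[OF D] s_def[symmetric] d_def[symmetric] B_def[symmetric] g1 g[OF z(1)] E
      using z(1) B by (simp add: field_simps)
    moreover have "complex_of_real (sieved_lambda 1 \<alpha> \<beta> n) = of_nat n - of_nat m + s"
      using False n by (simp add: sieved_lambda_def s_def)
    ultimately show ?thesis using D by (auto simp: field_differentiable_def)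
  qed
  then show "cmv_psi 1 \<alpha> \<beta> n field_differentiable (at z)"
    and "sieved_L 1 1 \<alpha> \<beta> (cmv_psi 1 \<alpha> \<beta> n) z
      = of_real (sieved_lambda 1 \<alpha> \<beta> n) * cmv_psi 1 \<alpha> \<beta> n z"
    by (simp_all add: g_def)
qed

section \<open>The sieved Laurent polynomials\<close>

text \<open>
  The exponent of \<open>z\<close> outside of \<open>z ^ N\<close> is fixed only modulo \<open>N\<close>. Taking the unsieved \<open>\<psi>\<close> of
  index \<open>k\<close> as the function of \<open>z ^ N\<close> selects a representative of absolute value at most
  \<open>N / 2\<close>, which is positive exactly if \<open>n\<close> and \<open>k\<close> have different parity.
\<close>

lemma cmv_psi_conv_jacobi:
  fixes n N :: nat
  assumes N: "N \<ge> 1" and z: "z \<noteq> 0"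
  defines "k \<equiv> n div N" and "j \<equiv> n mod N"
  shows "even n \<Longrightarrow> even k \<Longrightarrow> cmv_psi N \<alpha> \<beta> n z = cmv_psi 1 \<alpha> \<beta> k (z ^ N) / z ^ (j div 2)"
    and "odd n \<Longrightarrow> odd k \<Longrightarrow> cmv_psi N \<alpha> \<beta> n z = cmv_psi 1 \<alpha> \<beta> k (z ^ N) / z ^ ((N - 1 - j) div 2)"
    and "even n \<Longrightarrow> odd k \<Longrightarrow> cmv_psi N \<alpha> \<beta> n z = z ^ ((N - j) div 2) * cmv_psi 1 \<alpha> \<beta> k (1 / z ^ N)"
    and "odd n \<Longrightarrow> even k \<Longrightarrow> cmv_psi N \<alpha> \<beta> n z = z ^ ((j + 1) div 2) * cmv_psi 1 \<alpha> \<beta> k (1 / z ^ N)"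
proof -
  have n: "n = N * k + j" and j: "j < N" using N by (simp_all add: k_def j_def)
  have Phi: "poly (sieved_Phi N \<alpha> \<beta> n) w = w ^ j * poly (sieved_Phi 1 \<alpha> \<beta> k) (w ^ N)" for w
    using sieved_Phi_conv_jacobi[OF N, of \<alpha> \<beta> n w] by (simp add: k_def j_def)
  have pN: "(z ^ N) ^ l = z ^ (N * l)" "(1 / z) ^ N = 1 / z ^ N" for l
    by (simp_all add: power_mult power_divide)
  {
    assume "even n" "even k"
    then obtain l c where l: "k = 2 * l" and c: "j = 2 * c"
      using n by (metis dvd_add_right_iff dvd_mult evenE)
    have "n = 2 * (N * l + c)" using n l c by simp
    then show "cmv_psi N \<alpha> \<beta> n z = cmv_psi 1 \<alpha> \<beta> k (z ^ N) / z ^ (j div 2)"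
      using l c z unfolding cmv_psi_def Phi pN
      by (simp add: pN power_add mult_2 power_divide del: One_nat_def)
  next
    assume "odd n" "odd k"
    then obtain l m where l: "k = 2 * l + 1" and m: "n = 2 * m + 1" by (meson oddE)
    define c where "c = (N - 1 - j) div 2"
    have "2 * m = N * (2 * l) + (N - 1 + j)" using n l m N by (simp add: algebra_simps)
    then have "even (N - 1 + j)" by (metis dvd_add_right_iff dvd_triv_left mult.left_commute)
    moreover obtain t where t: "N = Suc (j + t)" using less_imp_Suc_add[OF j] by blast
    ultimately have "even t" by auto
    then have c: "N = 1 + j + 2 * c" by (simp add: c_def t)
    have "m = N * l + c + j" using n l m c by (simp add: algebra_simps)
    then have "z ^ m = z ^ (N * l) * z ^ c * z ^ j" by (simp add: power_add)
    then have "z ^ j / z ^ m = 1 / (z ^ (N * l) * z ^ c)" using z by simp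
    then show "cmv_psi N \<alpha> \<beta> n z = cmv_psi 1 \<alpha> \<beta> k (z ^ N) / z ^ ((N - 1 - j) div 2)"
      using z l m \<open>odd n\<close> \<open>odd k\<close> unfolding cmv_psi_def Phi pN c_def[symmetric]
      by (simp add: pN power_int_minus field_simps del: One_nat_def)
  next
    assume "even n" "odd k"
    then obtain l m where l: "k = 2 * l + 1" and m: "n = 2 * m" by (meson oddE evenE)
    define c where "c = (N - j) div 2"
    have "2 * m = N * (2 * l) + (N + j)" using n l m N by (simp add: algebra_simps)
    then have "even (N + j)" by (metis dvd_add_right_iff dvd_triv_left mult.left_commute)
    moreover obtain t where t: "N = Suc (j + t)" using less_imp_Suc_add[OF j] by blast
    ultimately have "even (Suc t)" by auto
    then have c: "N = j + 2 * c" by (simp add: c_def t)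
    have "m = N * l + c + j" using n l m c by (simp add: algebra_simps)
    then show "cmv_psi N \<alpha> \<beta> n z = z ^ ((N - j) div 2) * cmv_psi 1 \<alpha> \<beta> k (1 / z ^ N)"
      using z l m \<open>even n\<close> \<open>odd k\<close> unfolding cmv_psi_def Phi pN c_def[symmetric]
      by (simp add: pN power_add power_int_minus power_divide del: One_nat_def)
  next
    assume "odd n" "even k"
    then obtain l m where l: "k = 2 * l" and m: "n = 2 * m + 1" by (meson oddE evenE)
    define c where "c = (j + 1) div 2"
    have "2 * m + 1 = N * (2 * l) + j" using n l m N by simp
    then have "odd j" by (metis dvd_add_right_iff dvd_triv_left mult.left_commute odd_even_add even_plus_one_iff)
    then have c: "j + 1 = 2 * c" unfolding c_def by presburger
    have "m + c = N * l + j" using n l m c by (simp add: algebra_simps)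
    then have "z ^ m * z ^ c = z ^ (N * l) * z ^ j" by (simp add: power_add [symmetric])
    then have "z ^ j / z ^ m = z ^ c / z ^ (N * l)" using z by (simp add: field_simps)
    then show "cmv_psi N \<alpha> \<beta> n z = z ^ ((j + 1) div 2) * cmv_psi 1 \<alpha> \<beta> k (1 / z ^ N)"
      using z l m \<open>odd n\<close> \<open>even k\<close> unfolding cmv_psi_def Phi pN c_def[symmetric]
      by (simp add: pN power_int_minus power_divide field_simps del: One_nat_def)
  }
qed

theorem proposition1:
  fixes N :: nat and q :: complex and \<alpha> \<beta> :: real
  assumes "N \<ge> 1"
    and "primitive_unity_root N q"
    and "\<alpha> > -1"
    and "\<beta> > -1"
  shows "\<forall>n. \<forall>z. z \<noteq> 0 \<longrightarrow> (\<forall>k<N. z\<^sup>2 \<noteq> q ^ k) \<longrightarrow>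
           sieved_L N q \<alpha> \<beta> (cmv_psi N \<alpha> \<beta> n) z
             = of_real (sieved_lambda N \<alpha> \<beta> n) * cmv_psi N \<alpha> \<beta> n z"
proof (intro allI impI)
  fix n :: nat and z :: complex
  assume z: "z \<noteq> 0" and zq: "\<forall>k<N. z\<^sup>2 \<noteq> q ^ k"
  note N = assms(1)
  define k j where "k = n div N" and "j = n mod N"
  have n: "n = N * k + j" and j: "j < N" using N by (simp_all add: k_def j_def)
  define Z where "Z = z ^ N"
  have Z0: "Z \<noteq> 0" using z by (simp add: Z_def)
  have "(z\<^sup>2) ^ N \<noteq> 1"
    using sum_partial_fractions_primitive_root(1)[OF N assms(2) _ zq, of 1] z N by simp
  then have Z1: "Z\<^sup>2 \<noteq> 1" by (simp add: Z_def power_mult [symmetric] mult.commute)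
  then have Z1': "(1 / Z)\<^sup>2 \<noteq> 1" by (simp add: power_divide divide_eq_1_iff)
  have Z0': "1 / Z \<noteq> 0" using Z0 by simp
  note base = sieved_L_jacobi_psi[OF assms(3,4) Z0 Z1, unfolded Z_def, of k]
  note base' = sieved_L_jacobi_psi[OF assms(3,4) Z0' Z1', unfolded Z_def, of k]
  note psi = cmv_psi_conv_jacobi[OF N, of _ n \<alpha> \<beta>, folded k_def j_def]
  have nr: "real n = real N * real k + real j" by (simp add: n)
  let ?goal = "sieved_L N q \<alpha> \<beta> (cmv_psi N \<alpha> \<beta> n) z
    = of_real (sieved_lambda N \<alpha> \<beta> n) * cmv_psi N \<alpha> \<beta> n z"
  have high: ?goal
    if c: "2 * c < N" "sieved_lambda N \<alpha> \<beta> n = real N * sieved_lambda 1 \<alpha> \<beta> k - real c"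
      and psi: "\<And>z. z \<noteq> 0 \<Longrightarrow> cmv_psi N \<alpha> \<beta> n z = cmv_psi 1 \<alpha> \<beta> k (z ^ N) / z ^ c" for c
  proof -
    have "sieved_L N q \<alpha> \<beta> (cmv_psi N \<alpha> \<beta> n) z
      = (of_nat N * sieved_L 1 1 \<alpha> \<beta> (cmv_psi 1 \<alpha> \<beta> k) (z ^ N)
          - of_nat c * cmv_psi 1 \<alpha> \<beta> k (z ^ N)) / z ^ c"
      by (rule sieved_L_pullback[OF N assms(2) z zq c(1) psi base(1)])
    then show ?thesis
      unfolding base(2) psi[OF z] c(2) by (simp add: algebra_simps diff_divide_distrib)
  qed
  have low: ?goal
    if c: "1 \<le> c" "2 * c \<le> N"
        "sieved_lambda N \<alpha> \<beta> n = real c + real N * (\<alpha> + \<beta> + 1 - sieved_lambda 1 \<alpha> \<beta> k)"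
      and psi: "\<And>z. z \<noteq> 0 \<Longrightarrow> cmv_psi N \<alpha> \<beta> n z = z ^ c * cmv_psi 1 \<alpha> \<beta> k (1 / z ^ N)" for c
  proof -
    have "sieved_L N q \<alpha> \<beta> (cmv_psi N \<alpha> \<beta> n) z
      = z ^ c * (of_nat c * cmv_psi 1 \<alpha> \<beta> k (1 / z ^ N)
        + of_nat N * (of_real (\<alpha> + \<beta> + 1) * cmv_psi 1 \<alpha> \<beta> k (1 / z ^ N)
            - sieved_L 1 1 \<alpha> \<beta> (cmv_psi 1 \<alpha> \<beta> k) (1 / z ^ N)))"
      by (rule sieved_L_pullback_inverse[OF N assms(2) z zq c(1,2) psi base'(1)])
    then show ?thesis
      unfolding base'(2) psi[OF z] c(3) by (simp add: algebra_simps)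
  qed
  consider "even n" "even k" | "odd n" "odd k" | "even n" "odd k" | "odd n" "even k" by blast
  then show ?goal
  proof cases
    case 1
    then have ev: "even j" using n by (metis dvd_add_right_iff dvd_mult)
    show ?thesis
    proof (rule high[OF _ _ psi(1)])
      show "2 * (j div 2) < N" using j by linarith
      have "real (j div 2) = real j / 2" using ev by (simp add: real_of_nat_div)
      then show "sieved_lambda N \<alpha> \<beta> n = real N * sieved_lambda 1 \<alpha> \<beta> k - real (j div 2)"
        using 1 by (simp add: sieved_lambda_def nr field_simps)
    qed (use 1 in auto)
  next
    case 2
    have "even (N + j + 1)" using 2 n by auto
    moreover obtain t where t: "N = Suc (j + t)" using less_imp_Suc_add[OF j] by blast
    ultimately have "even t" by auto
    then have ev: "2 * ((N - 1 - j) div 2) + j + 1 = N" by (simp add: t)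
    then have "2 * real ((N - 1 - j) div 2) + real j + 1 = real N" by linarith
    then have c: "real ((N - 1 - j) div 2) = (real N - real j - 1) / 2" by (simp add: field_simps)
    show ?thesis
    proof (rule high[OF _ _ psi(2)])
      show "2 * ((N - 1 - j) div 2) < N" using ev by linarith
      show "sieved_lambda N \<alpha> \<beta> n = real N * sieved_lambda 1 \<alpha> \<beta> k - real ((N - 1 - j) div 2)"
        using 2 unfolding c by (simp add: sieved_lambda_def nr field_simps)
    qed (use 2 in auto)
  next
    case 3
    have "even (N + j)" using 3 n by auto
    moreover obtain t where t: "N = Suc (j + t)" using less_imp_Suc_add[OF j] by blast
    ultimately have "even (Suc t)" by auto
    then have ev: "2 * ((N - j) div 2) + j = N" by (simp add: t)
    then have "2 * real ((N - j) div 2) + real j = real N" by linarith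
    then have c: "real ((N - j) div 2) = (real N - real j) / 2" by (simp add: field_simps)
    show ?thesis
    proof (rule low[OF _ _ _ psi(3)])
      show "1 \<le> (N - j) div 2" "2 * ((N - j) div 2) \<le> N" using ev j by linarith+
      show "sieved_lambda N \<alpha> \<beta> n = real ((N - j) div 2) + real N * (\<alpha> + \<beta> + 1 - sieved_lambda 1 \<alpha> \<beta> k)"
        using 3 unfolding c by (simp add: sieved_lambda_def nr field_simps)
    qed (use 3 in auto)
  next
    case 4
    then have "odd j" using n by auto
    then have ev: "2 * ((j + 1) div 2) = j + 1" by presburger
    then have "2 * real ((j + 1) div 2) = real j + 1" by linarith
    then have c: "real ((j + 1) div 2) = (real j + 1) / 2" by (simp add: field_simps)
    show ?thesis
    proof (rule low[OF _ _ _ psi(4)])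
      show "1 \<le> (j + 1) div 2" "2 * ((j + 1) div 2) \<le> N" using ev j by linarith+
      show "sieved_lambda N \<alpha> \<beta> n = real ((j + 1) div 2) + real N * (\<alpha> + \<beta> + 1 - sieved_lambda 1 \<alpha> \<beta> k)"
        using 4 unfolding c by (simp add: sieved_lambda_def nr field_simps)
    qed (use 4 in auto)
  qed
qed

end
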